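(* Let $A \in \mathbb{C}^{m\times n}$ be a matrix that has at least one non-zero singular value and all of whose non-zero singular values are equal, and let $b \in \mathbb{C}^m$. Then the minimum 2-norm least-squares solution $x = A^{\dagger} b \in \mathbb{C}^n$ of the linear system $Ax=b$ is given componentwise, for $i = 1,\dots,n$, by $$x_i = \begin{cases} \dfrac{\left(\langle A^{(i)}, b\rangle\right)^{*}\,\langle A^{(i)}, b\rangle}{(A^{*}b)^{*}A^{*}A^{(i)}} & \text{if } b^{*}AA^{*}A^{(i)} \neq 0,\\[2ex] 0 & \text{otherwise.}\end{cases}$$
   Context: $A^*$ denotes the conjugate transpose of $A$ (and for a scalar, the complex conjugate). $A^{(i)} \in \mathbb{C}^m$ denotes the $i$-th column of $A$. For column vectors $v_1,v_2$ of the same size, $\langle v_1,v_2\rangle = v_1^* v_2$. $A^{\dagger}$ denotes the Moore–Penrose pseudoinverse of $A$; the least-squares solution of $Ax=b$ means the minimizer of $\|Ax-b\|_2$ having the smallest 2-norm, namely $A^{\dagger}b$. The system $Ax=b$ is not assumed to be consistent. *)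

theory Defs
  imports "HOL-Analysis.Analysis"
begin

definition conj_transpose :: "complex^'n^'m \<Rightarrow> complex^'m^'n" where
  "conj_transpose A = map_matrix cnj (transpose A)"

(* The inner product is conjugate-linear in the first argument. The library's (\<bullet>) on
   complex^'n is the real-valued Re of it, and norm is the norm induced by both. *)
definition cinner :: "complex^'n \<Rightarrow> complex^'n \<Rightarrow> complex" where
  "cinner v w = (\<Sum>k\<in>UNIV. cnj (v $ k) * w $ k)"

definition is_eigenvalue :: "complex^'n^'n \<Rightarrow> complex \<Rightarrow> bool" where
  "is_eigenvalue M l \<longleftrightarrow> (\<exists>v. v \<noteq> 0 \<and> M *v v = l *s v)"

(* Square roots of the eigenvalues of A* A. Conventions that count min(m, n) singular values
   differ from this one only in whether 0 is listed. *)
definition is_singular_value :: "complex^'n^'m \<Rightarrow> real \<Rightarrow> bool" where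
  "is_singular_value A s \<longleftrightarrow>
     s \<ge> 0 \<and> is_eigenvalue (conj_transpose A ** A) (complex_of_real (s\<^sup>2))"

(* The four Penrose conditions. *)
definition is_pinv :: "complex^'n^'m \<Rightarrow> complex^'m^'n \<Rightarrow> bool" where
  "is_pinv A X \<longleftrightarrow>
     A ** X ** A = A \<and>
     X ** A ** X = X \<and>
     conj_transpose (A ** X) = A ** X \<and>
     conj_transpose (X ** A) = X ** A"

definition pinv :: "complex^'n^'m \<Rightarrow> complex^'m^'n" where
  "pinv A = (THE X. is_pinv A X)"

definition is_least_squares_solution :: "complex^'n^'m \<Rightarrow> complex^'m \<Rightarrow> complex^'n \<Rightarrow> bool" where
  "is_least_squares_solution A b = is_arg_min (\<lambda>x. norm (A *v x - b)) (\<lambda>_. True)"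

definition is_min_norm_least_squares_solution ::
    "complex^'n^'m \<Rightarrow> complex^'m \<Rightarrow> complex^'n \<Rightarrow> bool" where
  "is_min_norm_least_squares_solution A b = is_arg_min norm (is_least_squares_solution A b)"

lemma conj_transpose_mult:
  "conj_transpose (A ** B) = conj_transpose B ** conj_transpose A"
  by (simp add: conj_transpose_def vec_eq_iff matrix_matrix_mult_def transpose_def mult.commute)

lemma is_pinv_unique:
  assumes X: "is_pinv A X" and Y: "is_pinv A Y"
  shows "X = Y"
proof -
  have AX: "A ** X = A ** Y"
  proof -
    have "A ** X = conj_transpose ((A ** Y) ** (A ** X))"
      using X Y by (metis is_pinv_def matrix_mul_assoc)
    also have "\<dots> = (A ** X) ** (A ** Y)"
      using X Y by (simp add: is_pinv_def conj_transpose_mult[of "A ** Y" "A ** X"])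
    also have "\<dots> = A ** Y"
      using X by (simp add: is_pinv_def matrix_mul_assoc)
    finally show ?thesis .
  qed
  have XA: "X ** A = Y ** A"
  proof -
    have "X ** A = conj_transpose ((X ** A) ** (Y ** A))"
      using X Y by (metis is_pinv_def matrix_mul_assoc)
    also have "\<dots> = (Y ** A) ** (X ** A)"
      using X Y by (simp add: is_pinv_def conj_transpose_mult[of "X ** A" "Y ** A"])
    also have "\<dots> = Y ** A"
      using X by (metis is_pinv_def matrix_mul_assoc)
    finally show ?thesis .
  qed
  have "X = X ** A ** X" using X by (simp add: is_pinv_def)
  also have "\<dots> = Y ** A ** Y" by (metis AX XA matrix_mul_assoc)
  also have "\<dots> = Y" using Y by (simp add: is_pinv_def)
  finally show ?thesis .
qed

lemma pinv_eqI: "is_pinv A X \<Longrightarrow> pinv A = X"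
  unfolding pinv_def by (rule the_equality) (auto intro: is_pinv_unique)

end

theory Submission
  imports Defs
begin

text \<open>
  Let \<open>s\<close> be the only non-zero singular value. By the spectral theorem the Hermitian matrix
  \<open>M = A\<^sup>*A\<close> satisfies \<open>M (M - s\<^sup>2) = 0\<close>: otherwise the range of \<open>M (M - s\<^sup>2)\<close>, being
  invariant under \<open>M\<close>, contains an eigenvector of \<open>M\<close>; its eigenvalue is \<open>0\<close> or \<open>s\<^sup>2\<close>, so it also
  lies in the kernel of \<open>M (M - s\<^sup>2)\<close>, which is orthogonal to the range. Hence
  \<open>A A\<^sup>* A = s\<^sup>2 A\<close>, so \<open>A\<^sup>* / s\<^sup>2\<close> satisfies the Penrose conditions and
  \<open>x\<^sub>i = \<langle>A\<^sup>(\<^sup>i\<^sup>), b\<rangle> / s\<^sup>2\<close>. The same identity turns the denominator of the formula into \<open>s\<^sup>2\<close> times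
  the conjugate of \<open>\<langle>A\<^sup>(\<^sup>i\<^sup>), b\<rangle>\<close>.
\<close>

section \<open>Spectral theory of self-adjoint maps\<close>

text \<open>Rayleigh quotient argument: a maximizer \<open>v\<close> of
  \<open>f x \<bullet> x\<close> on the unit sphere of \<open>S\<close> is an eigenvector.
  Invariance keeps the residual \<open>l *\<^sub>R v - f v\<close> in \<open>S\<close>, so it is an
  admissible direction of variation.\<close>

lemma self_adjoint_invariant_subspace_eigenvector:
  fixes f :: "'a::euclidean_space \<Rightarrow> 'a"
  assumes lin: "linear f" and self_adj: "\<And>x y. f x \<bullet> y = x \<bullet> f y"
    and S: "subspace S" and inv: "\<And>x. x \<in> S \<Longrightarrow> f x \<in> S"
    and nz: "u \<in> S" "u \<noteq> 0"
  obtains v l where "v \<in> S" "v \<noteq> 0" "f v = l *\<^sub>R v"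
proof -
  define K where "K = S \<inter> sphere 0 1"
  have "compact K"
    unfolding K_def by (intro closed_Int_compact closed_subspace S compact_sphere)
  moreover have "K \<noteq> {}"
  proof -
    have "(1 / norm u) *\<^sub>R u \<in> K"
      using nz S by (auto simp: K_def subspace_scale)
    then show ?thesis by blast
  qed
  moreover have "continuous_on K (\<lambda>x. f x \<bullet> x)"
    by (intro continuous_intros linear_continuous_on linear_linear[THEN iffD2] lin)
  ultimately obtain v where v: "v \<in> K" and sup: "\<And>y. y \<in> K \<Longrightarrow> f y \<bullet> y \<le> f v \<bullet> v"
    by (blast dest: continuous_attains_sup)
  define l where "l = f v \<bullet> v"
  \<comment> \<open>\<open>q\<close> is the quadratic form of \<open>l - f\<close>. By homogeneity,
    maximality of \<open>v\<close> makes it nonnegative on all of \<open>S\<close>, and it vanishes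
    at \<open>v\<close>.\<close>
  define q where "q y = l * (y \<bullet> y) - f y \<bullet> y" for y
  have q_nonneg: "q y \<ge> 0" if "y \<in> S" for y
  proof (cases "y = 0")
    case False
    define z where "z = (1 / norm y) *\<^sub>R y"
    have "z \<in> K"
      using that False S by (auto simp: K_def z_def subspace_scale)
    moreover have "y = norm y *\<^sub>R z"
      using False by (simp add: z_def)
    then have "f y \<bullet> y = (norm y)\<^sup>2 * (f z \<bullet> z)"
      by (metis inner_scaleR_left inner_scaleR_right lin linear_scale mult.assoc power2_eq_square)
    ultimately show ?thesis
      using sup[of z] by (simp add: q_def l_def dot_square_norm mult.commute mult_right_mono)
  qed (simp add: q_def lin linear_0)
  have vS: "v \<in> S" and vv: "v \<bullet> v = 1"
    using v by (auto simp: K_def dot_square_norm)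
  define w where "w = l *\<^sub>R v - f v"
  have wS: "w \<in> S"
    unfolding w_def using S inv vS by (intro subspace_diff subspace_scale)
  \<comment> \<open>first-order condition at the maximizer \<open>v\<close>, in the direction of the residual \<open>w\<close>\<close>
  have expand: "q (v + t *\<^sub>R w) = 2 * t * (w \<bullet> w) + t\<^sup>2 * q w" for t
  proof -
    have "f w \<bullet> v = f v \<bullet> w"
      by (metis self_adj inner_commute)
    moreover have "w \<bullet> w = l * (v \<bullet> w) - f v \<bullet> w"
      by (subst (1) w_def) (simp add: inner_diff_left)
    then have "2 * t * (w \<bullet> w) = 2 * t * (l * (v \<bullet> w) - f v \<bullet> w)"
      by (rule arg_cong)
    moreover have "w \<bullet> v = v \<bullet> w"
      by (rule inner_commute)
    ultimately show ?thesis
      using vv by (simp add: q_def linear_add[OF lin] linear_scale[OF lin] inner_add_left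
        inner_add_right l_def[symmetric] power2_eq_square algebra_simps)
  qed
  have "w \<bullet> w = 0"
  proof (rule ccontr)
    assume "w \<bullet> w \<noteq> 0"
    then have ww: "w \<bullet> w > 0" by simp
    \<comment> \<open>A small negative step makes the linear term of \<open>expand\<close> dominate
      and \<open>q\<close> negative. The \<open>+ 1\<close> keeps the denominator positive even if
      \<open>q w = 0\<close>.\<close>
    define t where "t = - (w \<bullet> w) / (q w + 1)"
    have qw: "q w \<ge> 0" by (rule q_nonneg[OF wS])
    have "t < 0" using ww qw by (simp add: t_def divide_neg_pos)
    have "t * (q w + 1) = - (w \<bullet> w)" using qw by (simp add: t_def)
    then have "2 * (w \<bullet> w) + t * q w = w \<bullet> w - t"
      by (simp add: algebra_simps)
    then have "2 * (w \<bullet> w) + t * q w > 0"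
      using ww \<open>t < 0\<close> by linarith
    then have "t * (2 * (w \<bullet> w) + t * q w) < 0"
      using \<open>t < 0\<close> by (simp add: mult_neg_pos)
    moreover have "q (v + t *\<^sub>R w) = t * (2 * (w \<bullet> w) + t * q w)"
      by (simp add: expand power2_eq_square algebra_simps)
    moreover have "q (v + t *\<^sub>R w) \<ge> 0"
      using S vS wS by (intro q_nonneg subspace_add subspace_scale)
    ultimately show False by simp
  qed
  then have "f v = l *\<^sub>R v" by (simp add: w_def)
  moreover have "v \<noteq> 0" using vv by auto
  ultimately show thesis using that vS by blast
qed

text \<open>Real scalars suffice for the application: the complex space is regarded as a Euclidean
  space, and \<open>A\<^sup>* A\<close> as a real-linear map on it.\<close>

lemma self_adjoint_quadratic_annihilator:
  fixes f :: "'a::euclidean_space \<Rightarrow> 'a"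
  assumes lin: "linear f" and self_adj: "\<And>x y. f x \<bullet> y = x \<bullet> f y"
    and ev: "\<And>v l. v \<noteq> 0 \<Longrightarrow> f v = l *\<^sub>R v \<Longrightarrow> l = 0 \<or> l = c"
  shows "f (f x) = c *\<^sub>R f x"
proof (rule ccontr)
  define g where "g x = f (f x) - c *\<^sub>R f x" for x
  have lin_g: "linear g"
    unfolding g_def
    by (intro linear_compose_sub linear_compose_scale_right lin linear_compose[OF lin lin, unfolded o_def])
  have g_self_adj: "g x \<bullet> y = x \<bullet> g y" for x y
    by (simp add: g_def inner_diff_left inner_diff_right self_adj)
  assume "f (f x) \<noteq> c *\<^sub>R f x"
  then have "g x \<noteq> 0" by (simp add: g_def)
  \<comment> \<open>\<open>g\<close> is a polynomial in \<open>f\<close>, so the two maps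
    commute.\<close>
  moreover have "f y \<in> range g" if y: "y \<in> range g" for y
  proof -
    obtain z where "y = g z" using y by blast
    then have "f y = g (f z)"
      by (simp add: g_def linear_diff[OF lin] linear_scale[OF lin])
    then show ?thesis by blast
  qed
  ultimately obtain v l where v: "v \<in> range g" "v \<noteq> 0" "f v = l *\<^sub>R v"
    using self_adjoint_invariant_subspace_eigenvector[OF lin self_adj
        linear_subspace_image[OF lin_g subspace_UNIV]] by (metis rangeI)
  then have "g v = 0"
    using ev[of v l] by (auto simp: g_def linear_scale[OF lin])
  moreover obtain z where "v = g z" using v by blast
  ultimately have "v \<bullet> v = 0"
    by (metis g_self_adj inner_zero_right)
  then show False using v by simp
qed

section \<open>Algebra of the conjugate transpose and of the two inner products\<close>

lemma conj_transpose_conj_transpose [simp]: "conj_transpose (conj_transpose A) = A"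
  by (simp add: conj_transpose_def transpose_def vec_eq_iff)

lemma conj_transpose_scaleR: "conj_transpose (r *\<^sub>R A) = r *\<^sub>R conj_transpose A"
  by (simp add: conj_transpose_def transpose_def vec_eq_iff)

lemma matrix_mult_scaleR_left: "(r *\<^sub>R A) ** B = r *\<^sub>R (A ** (B :: complex^'n^'k))"
  by (simp add: matrix_matrix_mult_def vec_eq_iff scaleR_sum_right)

lemma matrix_mult_scaleR_right: "A ** (r *\<^sub>R B) = r *\<^sub>R (A ** (B :: complex^'n^'k))"
  by (simp add: matrix_matrix_mult_def vec_eq_iff scaleR_sum_right)

lemma matrix_vector_mult_scaleR_left: "(r *\<^sub>R A) *v x = r *\<^sub>R (A *v (x :: complex^'n))"
  by (simp add: matrix_vector_mult_def vec_eq_iff scaleR_sum_right)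

lemma linear_complex_matrix_vector_mult: "linear ((*v) (A :: complex^'n^'m))"
  by (intro linearI) (simp_all add: matrix_vector_mult_def vec_eq_iff scaleR_sum_right
    distrib_left sum.distrib)

lemma cinner_scaleR_right: "cinner v (r *\<^sub>R w) = of_real r * cinner v w"
  by (simp add: cinner_def sum_distrib_left scaleR_conv_of_real[where x = "_ :: complex"] mult_ac)

lemma cinner_commute: "cinner v w = cnj (cinner w v)"
  by (simp add: cinner_def mult.commute)

lemma inner_eq_Re_cinner: "v \<bullet> w = Re (cinner v w)"
  by (simp add: cinner_def inner_vec_def inner_complex_def)

lemma cinner_conj_transpose: "cinner (conj_transpose A *v v) w = cinner v (A *v w)"
proof -
  have "cinner (conj_transpose A *v v) w = (\<Sum>j\<in>UNIV. \<Sum>i\<in>UNIV. cnj (v $ i) * (A $ i $ j * w $ j))"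
    by (simp add: cinner_def conj_transpose_def transpose_def matrix_vector_mult_def
        sum_distrib_left sum_distrib_right mult_ac)
  also have "\<dots> = cinner v (A *v w)"
    by (subst sum.swap) (simp add: cinner_def matrix_vector_mult_def sum_distrib_left)
  finally show ?thesis .
qed

text \<open>Taking real parts makes the adjoint available for the real inner product, which governs
  norms and the spectral lemmas.\<close>

lemma inner_conj_transpose_left: "(conj_transpose A *v v) \<bullet> w = v \<bullet> (A *v w)"
  by (simp add: inner_eq_Re_cinner cinner_conj_transpose)

lemma inner_conj_transpose_right: "v \<bullet> (conj_transpose A *v w) = (A *v v) \<bullet> w"
  by (metis inner_commute inner_conj_transpose_left)

lemma conj_transpose_mult_vector_nth: "(conj_transpose A *v b) $ i = cinner (column i A) b"
  by (simp add: conj_transpose_def transpose_def matrix_vector_mult_def cinner_def column_def)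

lemma matrix_mult_column: "(A :: complex^'n^'m) *v column i B = column i (A ** B)"
  by (simp add: matrix_vector_mult_def matrix_matrix_mult_def column_def vec_eq_iff)

section \<open>Least squares through the Penrose conditions\<close>

lemma norm_add_orthogonal:
  fixes u v :: "'a::real_inner"
  assumes "u \<bullet> v = 0"
  shows "(norm (u + v))\<^sup>2 = (norm u)\<^sup>2 + (norm v)\<^sup>2"
  using assms by (simp add: power2_norm_eq_inner inner_add_left inner_add_right inner_commute)

text \<open>The residual at \<open>X *v b\<close> is orthogonal to the range of \<open>A\<close>, so
  Pythagoras splits every other residual.\<close>

lemma is_pinv_least_squares_iff:
  assumes "is_pinv A X"
  shows "is_least_squares_solution A b y \<longleftrightarrow> A *v y = A *v (X *v b)"
proof -
  let ?x = "X *v b"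
  have AX: "A ** X ** A = A" "conj_transpose (A ** X) = A ** X"
    using assms by (simp_all add: is_pinv_def)
  \<comment> \<open>The adjoint of \<open>A X A = A\<close>, with \<open>A X\<close> Hermitian,
    yields the normal equations.\<close>
  have "conj_transpose A ** (A ** X) = conj_transpose (A ** X ** A)"
    by (simp only: conj_transpose_mult[of "A ** X"] AX(2))
  then have normal: "conj_transpose A *v (A *v ?x - b) = 0"
    by (simp add: AX matrix_vector_mult_diff_distrib matrix_vector_mul_assoc matrix_mul_assoc)
  have split: "(norm (A *v z - b))\<^sup>2 = (norm (A *v z - A *v ?x))\<^sup>2 + (norm (A *v ?x - b))\<^sup>2" for z
  proof -
    have "(A *v (z - ?x)) \<bullet> (A *v ?x - b) = 0"
      by (metis inner_conj_transpose_right normal inner_zero_right)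
    then show ?thesis
      using norm_add_orthogonal[of "A *v z - A *v ?x" "A *v ?x - b"]
      by (simp add: matrix_vector_mult_diff_distrib)
  qed
  have le: "norm (A *v ?x - b) \<le> norm (A *v z - b)" for z
    by (rule power2_le_imp_le) (simp_all add: split[of z])
  have "norm (A *v y - b) \<le> norm (A *v ?x - b) \<longleftrightarrow> A *v y = A *v ?x"
  proof
    assume "norm (A *v y - b) \<le> norm (A *v ?x - b)"
    then have "(norm (A *v y - b))\<^sup>2 \<le> (norm (A *v ?x - b))\<^sup>2"
      by (simp add: power_mono)
    then show "A *v y = A *v ?x" by (simp add: split[of y])
  qed simp
  then show ?thesis
    using le unfolding is_least_squares_solution_def is_arg_min_def
    by (meson linorder_not_le order_trans)
qed

text \<open>The least-squares solutions form the coset of the kernel of \<open>A\<close> through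
  \<open>X *v b\<close>. This vector is fixed by the Hermitian matrix \<open>X A\<close>, hence
  orthogonal to that kernel and the shortest in the coset.\<close>

lemma is_pinv_min_norm_least_squares_iff:
  assumes "is_pinv A X"
  shows "is_min_norm_least_squares_solution A b y \<longleftrightarrow> y = X *v b"
proof -
  let ?x = "X *v b"
  have XA: "X ** A ** X = X" "conj_transpose (X ** A) = X ** A"
    using assms by (simp_all add: is_pinv_def)
  have split: "(norm y)\<^sup>2 = (norm (y - ?x))\<^sup>2 + (norm ?x)\<^sup>2" if "A *v y = A *v ?x" for y
  proof -
    have "(X ** A) *v (y - ?x) = 0"
      using that
      by (simp add: matrix_vector_mult_diff_distrib flip: matrix_vector_mul_assoc)
    moreover have "(X ** A) *v ?x = ?x"
      by (simp add: matrix_vector_mul_assoc XA)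
    ultimately have "(y - ?x) \<bullet> ?x = 0"
      by (metis XA(2) inner_conj_transpose_right inner_zero_left)
    then show ?thesis
      using norm_add_orthogonal[of "y - ?x" ?x] by simp
  qed
  have le: "norm ?x \<le> norm z" if "A *v z = A *v ?x" for z
    by (rule power2_le_imp_le) (simp_all add: split[OF that])
  have eq: "y = ?x" if "A *v y = A *v ?x" "norm y \<le> norm ?x"
  proof -
    have "(norm y)\<^sup>2 \<le> (norm ?x)\<^sup>2"
      using that by (simp add: power_mono)
    then show ?thesis by (simp add: split[OF that(1)])
  qed
  show ?thesis
    unfolding is_min_norm_least_squares_solution_def is_arg_min_def
      is_pinv_least_squares_iff[OF assms]
    using le eq by (metis linorder_not_le)
qed

section \<open>Matrices with a single non-zero singular value\<close>

lemma unique_singular_value_mult: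
  fixes A :: "complex^'n^'m"
  assumes uniq: "\<And>t. is_singular_value A t \<Longrightarrow> t \<noteq> 0 \<Longrightarrow> t = s"
  shows "A ** conj_transpose A ** A = s\<^sup>2 *\<^sub>R A"
proof -
  define f where "f v = conj_transpose A *v (A *v v)" for v
  have f_M: "f v = (conj_transpose A ** A) *v v" for v
    by (simp add: f_def matrix_vector_mul_assoc)
  have lin: "linear f"
    unfolding f_M[abs_def] by (rule linear_complex_matrix_vector_mult)
  have inner_f: "v \<bullet> f w = (A *v v) \<bullet> (A *v w)" for v w
    by (simp add: f_def inner_conj_transpose_right)
  have ev: "l = 0 \<or> l = s\<^sup>2" if v: "v \<noteq> 0" "f v = l *\<^sub>R v" for v l
  proof -
    \<comment> \<open>Nonnegativity of \<open>l\<close> is needed for \<open>sqrt l\<close> to be a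
      singular value.\<close>
    have "l * (v \<bullet> v) = (A *v v) \<bullet> (A *v v)"
      using inner_f[of v v] v by simp
    then have "l \<ge> 0"
      using v by (metis inner_ge_zero inner_gt_zero_iff zero_le_mult_iff linorder_not_less)
    moreover have "(conj_transpose A ** A) *v v = complex_of_real l *s v"
      using v by (simp add: f_M vec_eq_iff scaleR_conv_of_real[where x = "_ :: complex"])
    ultimately have "is_singular_value A (sqrt l)"
      using v by (auto simp: is_singular_value_def is_eigenvalue_def)
    then show ?thesis
      using uniq \<open>l \<ge> 0\<close> by force
  qed
  have ff: "f (f v) = s\<^sup>2 *\<^sub>R f v" for v
    by (rule self_adjoint_quadratic_annihilator[OF lin _ ev])
      (metis inner_f inner_commute)
  have "A *v f v = s\<^sup>2 *\<^sub>R (A *v v)" for v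
  proof -
    \<comment> \<open>The leading \<open>A\<^sup>*\<close> is cancelled:
      \<open>A\<^sup>* A u = 0\<close> forces \<open>A u = 0\<close>, since the squared norm of
      \<open>A u\<close> is \<open>u \<bullet> f u\<close>.\<close>
    let ?u = "f v - s\<^sup>2 *\<^sub>R v"
    have "f ?u = 0"
      by (simp add: linear_diff[OF lin] linear_scale[OF lin] ff)
    then have "A *v ?u = 0"
      using inner_f[of ?u ?u] by simp
    then show ?thesis
      by (simp add: matrix_vector_mult_diff_distrib
          linear_scale[OF linear_complex_matrix_vector_mult])
  qed
  then show ?thesis
    by (simp add: matrix_eq f_def matrix_vector_mult_scaleR_left flip: matrix_vector_mul_assoc)
qed

text \<open>The first two Penrose conditions are \<open>eq\<close> and its adjoint, rescaled; the
  other two hold because \<open>c\<close> is real.\<close>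

lemma is_pinv_scaled_conj_transpose:
  assumes eq: "A ** conj_transpose A ** A = c *\<^sub>R A" and c: "c \<noteq> 0"
  shows "is_pinv A ((1 / c) *\<^sub>R conj_transpose A)"
proof -
  have "conj_transpose (A ** conj_transpose A ** A) = conj_transpose (c *\<^sub>R A)"
    by (simp only: eq)
  then have "conj_transpose A ** A ** conj_transpose A = c *\<^sub>R conj_transpose A"
    by (simp add: conj_transpose_mult conj_transpose_scaleR matrix_mul_assoc)
  then show ?thesis
    using c by (simp add: is_pinv_def matrix_mult_scaleR_left matrix_mult_scaleR_right eq
      conj_transpose_scaleR conj_transpose_mult)
qed

theorem theorem3p1:
  fixes A :: "complex^'n^'m" and b :: "complex^'m" and x :: "complex^'n"
  assumes "\<exists>s. is_singular_value A s \<and> s \<noteq> 0"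
    and "\<forall>s t. is_singular_value A s \<and> s \<noteq> 0 \<and> is_singular_value A t \<and> t \<noteq> 0 \<longrightarrow> s = t"
    and "x = pinv A *v b"
  shows "(\<forall>y. is_min_norm_least_squares_solution A b y \<longleftrightarrow> y = x) \<and>
    (\<forall>i. x $ i =
      (if cinner b ((A ** conj_transpose A) *v column i A) \<noteq> 0
       then cnj (cinner (column i A) b) * cinner (column i A) b /
              cinner (conj_transpose A *v b) (conj_transpose A *v column i A)
       else 0))"
proof -
  obtain s where s: "is_singular_value A s" "s \<noteq> 0"
    using assms(1) by blast
  have eq: "A ** conj_transpose A ** A = s\<^sup>2 *\<^sub>R A"
    using assms(2) s by (intro unique_singular_value_mult) blast
  have pinv: "is_pinv A ((1 / s\<^sup>2) *\<^sub>R conj_transpose A)"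
    using is_pinv_scaled_conj_transpose[OF eq] s by simp
  have x: "x = ((1 / s\<^sup>2) *\<^sub>R conj_transpose A) *v b"
    using assms(3) pinv_eqI[OF pinv] by simp
  have "x $ i =
      (if cinner b ((A ** conj_transpose A) *v column i A) \<noteq> 0
       then cnj (cinner (column i A) b) * cinner (column i A) b /
              cinner (conj_transpose A *v b) (conj_transpose A *v column i A)
       else 0)" for i
  proof -
    let ?c = "cinner (column i A) b"
    have "column i (s\<^sup>2 *\<^sub>R A) = s\<^sup>2 *\<^sub>R column i A"
      by (simp add: column_def vec_eq_iff)
    \<comment> \<open>The vector \<open>A A\<^sup>* A\<^sup>(\<^sup>i\<^sup>)\<close> is the
      \<open>i\<close>-th column of \<open>A A\<^sup>* A\<close>, which is
      \<open>s\<^sup>2 *\<^sub>R A\<close>.\<close>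
    then have cond: "cinner b ((A ** conj_transpose A) *v column i A) = of_real (s\<^sup>2) * cnj ?c"
      by (simp only: matrix_mult_column eq cinner_scaleR_right cinner_commute[of b])
    have "cinner (conj_transpose A *v b) (conj_transpose A *v column i A)
        = cinner b ((A ** conj_transpose A) *v column i A)"
      by (simp add: cinner_conj_transpose matrix_vector_mul_assoc)
    moreover have "x $ i = ?c / of_real (s\<^sup>2)"
      unfolding x matrix_vector_mult_scaleR_left vector_scaleR_component
        conj_transpose_mult_vector_nth
      by (simp add: scaleR_conv_of_real)
    \<comment> \<open>As \<open>s\<close> is non-zero, the case condition means
      \<open>?c \<noteq> 0\<close>. Then \<open>cnj ?c\<close> cancels from the quotient; otherwise
      both sides are zero.\<close>
    ultimately show ?thesis
      using s by (simp add: cond)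
  qed
  then show ?thesis
    using is_pinv_min_norm_least_squares_iff[OF pinv] x by blast
qed

end
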